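(* Let $G$ be a simple graph on $n$ vertices with at least one edge, and let $0=\mu_1\le\mu_2\le\cdots\le\mu_n$ be the eigenvalues of its Laplacian matrix. If $\frac{\mu_2}{\mu_n}\ge\frac45$, then $G$ has a $2$-walk.
   Context: The Laplacian matrix of $G$ is $L=D-A$ ($D$ diagonal degree matrix, $A$ adjacency matrix); $\mu_i$ is its $i$-th smallest eigenvalue. A $k$-walk in $G$ is a closed spanning walk in $G$ that visits every vertex of $G$ at most $k$ times. *)

theory Defs
  imports
    "Graph_Theory.Graph_Theory"
    "Jordan_Normal_Form.Char_Poly"
    "HOL-Computational_Algebra.Polynomial"
begin

text \<open>
  A finite simple graph is a symmetric loop-free digraph without parallel arcs
  (locale \<^locale>\<open>pair_graph\<close>): an edge joining \<open>x\<close> and \<open>y\<close> is the pair of arcs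
  \<open>(x, y)\<close>, \<open>(y, x)\<close>, so the degree of a vertex is its out-degree.

  Matrices are indexed by \<open>0, ..., n - 1\<close>. The list \<open>vs\<close> is an enumeration of the vertices
  (\<open>distinct vs\<close>, \<open>set vs = pverts G\<close>), with \<open>vs ! i\<close> the vertex belonging to index \<open>i\<close>.
\<close>

definition adjacency_matrix :: "'a pair_pre_digraph \<Rightarrow> 'a list \<Rightarrow> real mat" where
  "adjacency_matrix G vs = mat (length vs) (length vs)
     (\<lambda>(i, j). if (vs ! i, vs ! j) \<in> parcs G then 1 else 0)"

definition degree_matrix :: "'a pair_pre_digraph \<Rightarrow> 'a list \<Rightarrow> real mat" where
  "degree_matrix G vs = mat (length vs) (length vs)
     (\<lambda>(i, j). if i = j then real (out_degree (with_proj G) (vs ! i)) else 0)"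

definition laplacian_matrix :: "'a pair_pre_digraph \<Rightarrow> 'a list \<Rightarrow> real mat" where
  "laplacian_matrix G vs = degree_matrix G vs - adjacency_matrix G vs"

text \<open>
  The \<open>i\<close>-th smallest eigenvalue, for \<open>i = 1, ..., n\<close>: eigenvalues are repeated according to
  their multiplicity as roots of the characteristic polynomial. The Laplacian is a real symmetric
  matrix, so it has exactly \<open>n\<close> real eigenvalues in this sense.
\<close>

definition laplacian_eigenvalue :: "'a pair_pre_digraph \<Rightarrow> 'a list \<Rightarrow> nat \<Rightarrow> real" where
  "laplacian_eigenvalue G vs i =
     sorted_list_of_multiset (proots (char_poly (laplacian_matrix G vs))) ! (i - 1)"

text \<open>
  The visits of the closed walk \<open>v\<^sub>0, v\<^sub>1, ..., v\<^sub>m = v\<^sub>0\<close> are \<open>v\<^sub>1, ..., v\<^sub>m\<close>: the common start and end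
  vertex is not counted twice, so that for example a Hamilton cycle is a 1-walk. The walk without
  arcs visits its only vertex once.
\<close>

definition closed_walk_visits ::
    "'a pair_pre_digraph \<Rightarrow> 'a \<Rightarrow> ('a \<times> 'a) awalk \<Rightarrow> 'a list" where
  "closed_walk_visits G u p =
     (if p = [] then [u] else tl (pre_digraph.awalk_verts (with_proj G) u p))"

definition is_k_walk ::
    "nat \<Rightarrow> 'a pair_pre_digraph \<Rightarrow> 'a \<Rightarrow> ('a \<times> 'a) awalk \<Rightarrow> bool" where
  "is_k_walk k G u p \<longleftrightarrow>
     pre_digraph.awalk (with_proj G) u p u \<and>
     set (pre_digraph.awalk_verts (with_proj G) u p) = pverts G \<and>
     (\<forall>v \<in> pverts G. count_list (closed_walk_visits G u p) v \<le> k)"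

end

theory Submission
  imports Defs "HOL-Analysis.Function_Topology"
begin

text \<open>
  Testing the Rayleigh quotient on combinations of two indicator functions shows that disjoint
  non-adjacent sets \<open>X\<close>, \<open>Y\<close> satisfy \<open>81 |X| |Y| \<le> (n - |X|) (n - |Y|)\<close>. In particular two such sets of
  equal size have at most \<open>n/10\<close> vertices, so depth-first search yields a path on at least \<open>4n/5\<close>
  vertices, and an edge between its first and last segment (of slightly more than \<open>n/10\<close> vertices
  each) closes a cycle \<open>C\<close> that misses a set \<open>R\<close> of at most \<open>2n/5\<close> vertices. Every \<open>X \<subseteq> R\<close> has at least
  \<open>|X|\<close> neighbours outside \<open>X\<close>; by iterating Hall's theorem the vertices of \<open>R\<close> can therefore be hung
  onto \<open>C\<close> one after another as leaves, each vertex receiving at most one leaf. A leaf \<open>u\<close> hung onto \<open>x\<close>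
  is visited by the detour \<open>x, u, x\<close>, which costs one additional visit of \<open>x\<close>.
\<close>

section \<open>Two-walks in expanders\<close>

lemma count_list_distinct_le: "distinct xs \<Longrightarrow> count_list xs v \<le> 1"
  by (induction xs) auto

section \<open>Hall's marriage theorem for finite families\<close>

text \<open>Induction on \<open>card Z\<close>. If some nonempty proper \<open>X\<close> is tight,
  \<open>X\<close> is matched into its union and \<open>Z - X\<close> outside that union. If none is
  tight, every such \<open>X\<close> has a surplus, so any value may be given to one element
  \<open>z\<close> and withheld from the others.\<close>

lemma hall_marriage:
  assumes "finite Z" "\<And>z. z \<in> Z \<Longrightarrow> finite (S z)"
    and "\<And>X. X \<subseteq> Z \<Longrightarrow> card X \<le> card (\<Union>x\<in>X. S x)"
  shows "\<exists>f. inj_on f Z \<and> (\<forall>z\<in>Z. f z \<in> S z)"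
  using assms
proof (induction "card Z" arbitrary: Z S rule: less_induct)
  case less
  have finU: "finite (\<Union>x\<in>X. S x)" if "X \<subseteq> Z" for X
    using that less.prems(1,2) by (meson finite_UN_I finite_subset in_mono)
  show ?case
  proof (cases "Z = {}")
    case True
    then show ?thesis by simp
  next
    case False
    then obtain z where z: "z \<in> Z" by blast
    show ?thesis
    proof (cases "\<exists>X. X \<subset> Z \<and> X \<noteq> {} \<and> card (\<Union>x\<in>X. S x) = card X")
      case True
      then obtain X where X: "X \<subset> Z" "X \<noteq> {}" "card (\<Union>x\<in>X. S x) = card X" by blast
      define T where "T = (\<Union>x\<in>X. S x)"
      have finX: "finite X" using X(1) less.prems(1) finite_subset by blast
      have finT: "finite T" unfolding T_def using X(1) by (intro finU) auto
      have "\<exists>f. inj_on f X \<and> (\<forall>z\<in>X. f z \<in> S z)"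
        using less.prems X(1) finX by (intro less.hyps) (auto simp: psubset_card_mono)
      then obtain f where f: "inj_on f X" "\<And>z. z \<in> X \<Longrightarrow> f z \<in> S z" by blast
      \<comment> \<open>Discarding \<open>T\<close> preserves Hall's condition on
        \<open>Z - X\<close>: in the condition for \<open>X \<union> Y\<close>, the tight set
        \<open>X\<close> accounts for exactly \<open>card T = card X\<close> elements.\<close>
      have "\<exists>g. inj_on g (Z - X) \<and> (\<forall>z\<in>Z - X. g z \<in> S z - T)"
      proof (rule less.hyps)
        show "card (Z - X) < card Z"
          using X(1,2) less.prems(1) by (intro psubset_card_mono) auto
        fix Y assume Y: "Y \<subseteq> Z - X"
        have "card X + card Y = card (X \<union> Y)"
          using Y finX less.prems(1) by (subst card_Un_disjoint) (auto intro: finite_subset)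
        also have "\<dots> \<le> card (\<Union>x\<in>X \<union> Y. S x)"
          using Y X(1) by (intro less.prems(3)) auto
        also have "(\<Union>x\<in>X \<union> Y. S x) = T \<union> (\<Union>x\<in>Y. S x - T)"
          unfolding T_def by blast
        also have "card \<dots> \<le> card T + card (\<Union>x\<in>Y. S x - T)"
          by (rule card_Un_le)
        finally show "card Y \<le> card (\<Union>x\<in>Y. S x - T)"
          using X(3) by (simp add: T_def)
      qed (use less.prems in auto)
      then obtain g where g: "inj_on g (Z - X)" "\<And>z. z \<in> Z - X \<Longrightarrow> g z \<in> S z - T" by blast
      have fT: "f x \<in> T" if "x \<in> X" for x
        using f(2) that unfolding T_def by blast
      have ne: "f x \<noteq> g y" if "x \<in> X" "y \<in> Z - X" for x y
        using fT g(2) that by fastforce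
      have "inj_on (\<lambda>x. if x \<in> X then f x else g x) Z"
      proof (rule inj_onI)
        fix x y assume "x \<in> Z" "y \<in> Z"
          "(if x \<in> X then f x else g x) = (if y \<in> X then f y else g y)"
        then show "x = y"
          using f(1) g(1) ne[of x y] ne[of y x]
          by (auto split: if_splits dest: inj_onD)
      qed
      moreover have "\<forall>x\<in>Z. (if x \<in> X then f x else g x) \<in> S x"
        using f(2) g(2) by auto
      ultimately show ?thesis by blast
    next
      case False
      have "S z \<noteq> {}"
        using less.prems(3)[of "{z}"] z by auto
      then obtain y where y: "y \<in> S z" by blast
      \<comment> \<open>Removing the single value \<open>y\<close> lowers each union by at most one,
        which the strict surplus of proper subsets absorbs.\<close>
      have "\<exists>f. inj_on f (Z - {z}) \<and> (\<forall>x\<in>Z - {z}. f x \<in> S x - {y})"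
      proof (rule less.hyps)
        show "card (Z - {z}) < card Z"
          using z less.prems(1) by (intro psubset_card_mono) auto
        fix X assume X: "X \<subseteq> Z - {z}"
        show "card X \<le> card (\<Union>x\<in>X. S x - {y})"
        proof (cases "X = {}")
          case False
          have "X \<subset> Z" using X z by auto
          then have "card X < card (\<Union>x\<in>X. S x)"
            using less.prems(3)[of X] \<open>\<not> (\<exists>X. _ X)\<close> False by (metis order_le_less psubset_imp_subset)
          moreover have "(\<Union>x\<in>X. S x - {y}) = (\<Union>x\<in>X. S x) - {y}" by blast
          moreover have "finite (\<Union>x\<in>X. S x)" using \<open>X \<subset> Z\<close> by (intro finU) auto
          ultimately show ?thesis by (auto simp: card_Diff_singleton_if)
        qed simp
      qed (use less.prems in auto)
      then obtain f where f: "inj_on f (Z - {z})" "\<And>x. x \<in> Z - {z} \<Longrightarrow> f x \<in> S x - {y}" by blast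
      have "(f(z := y)) x \<in> S x" if "x \<in> Z" for x using f(2) y that by auto
      moreover have "inj_on (f(z := y)) Z"
        using f unfolding inj_on_def by (auto dest!: f(2))
      ultimately show ?thesis by blast
    qed
  qed
qed

section \<open>Hanging leaves onto a closed walk\<close>

text \<open>The detour \<open>x, u, x\<close> replaces one occurrence of \<open>x\<close>. A closed
  walk is a vertex list whose first entry is repeated at the end, so its visits are the entries of
  \<open>tl w\<close>; the count remains right when \<open>x\<close> is the starting vertex.\<close>

lemma attach_leaf:
  assumes "successively R w" "hd w = last w" "x \<in> set w" "R x u" "R u x"
  shows "\<exists>w'. successively R w' \<and> hd w' = last w' \<and> set w' = insert u (set w) \<and>
    (\<forall>v. count_list (tl w') v = count_list (tl w) v + (if v = x then 1 else 0) + (if v = u then 1 else 0))"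
proof -
  obtain xs ys where w: "w = xs @ x # ys" using assms(3) by (meson split_list)
  have "successively R (xs @ x # u # x # ys)"
    using assms(1,4,5) unfolding w by (auto simp: successively_append_iff successively_Cons)
  moreover have "hd (xs @ x # u # x # ys) = last (xs @ x # u # x # ys)"
    using assms(2) unfolding w by (cases xs) auto
  ultimately show ?thesis
    by (intro exI[of _ "xs @ x # u # x # ys"]) (cases xs; auto simp: w)
qed

text \<open>Detours never remove vertices, so every anchor \<open>f z\<close> is still present when
  its turn comes. Injectivity of \<open>f\<close> charges each anchor only once.\<close>

lemma attach_leaves:
  assumes "finite Z" "successively R w" "hd w = last w" "inj_on f Z" "f ` Z \<subseteq> set w"
    "\<And>z. z \<in> Z \<Longrightarrow> R (f z) z \<and> R z (f z)"
  shows "\<exists>w'. successively R w' \<and> hd w' = last w' \<and> set w' = set w \<union> Z \<and>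
    (\<forall>v. count_list (tl w') v = count_list (tl w) v + (if v \<in> f ` Z then 1 else 0) + (if v \<in> Z then 1 else 0))"
  using assms
proof (induction Z)
  case empty
  then show ?case by auto
next
  case (insert z Z)
  then obtain w' where w': "successively R w'" "hd w' = last w'" "set w' = set w \<union> Z"
    "\<And>v. count_list (tl w') v = count_list (tl w) v + (if v \<in> f ` Z then 1 else 0) + (if v \<in> Z then 1 else 0)"
    by auto
  have "f z \<in> set w'" using insert.prems w'(3) by auto
  then obtain w'' where w'': "successively R w''" "hd w'' = last w''" "set w'' = insert z (set w')"
    "\<And>v. count_list (tl w'') v = count_list (tl w') v + (if v = f z then 1 else 0) + (if v = z then 1 else 0)"
    using attach_leaf[of R w' "f z" z] w' insert.prems(5)[of z] by auto
  have "f z \<notin> f ` Z" using insert.prems(3) insert.hyps(2) by auto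
  then show ?case
    using w'' w' insert.hyps by (intro exI[of _ w'']) auto
qed

text \<open>
  Let \<open>X \<subseteq> R\<close> be a largest set with fewer than \<open>|X|\<close> neighbours outside \<open>R\<close>. By maximality Hall's
  condition holds for matching \<open>R - X\<close> into the walk while avoiding the neighbours of \<open>X\<close>. Hence the
  neighbours of \<open>X\<close> stay visited at most once, and the induction continues with \<open>X\<close> in place of \<open>R\<close>.
\<close>
lemma absorb_into_closed_walk:
  assumes "finite V" "sym E" "E \<subseteq> V \<times> V" "R \<subseteq> V"
    and "\<And>X. X \<subseteq> R \<Longrightarrow> X \<noteq> {} \<Longrightarrow> card X \<le> card (E `` X - X)"
    and "successively (\<lambda>u v. (u, v) \<in> E) w" "hd w = last w" "set w = V - R"
    and "\<And>v. count_list (tl w) v \<le> 2"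
    and "\<And>v. v \<in> E `` R - R \<Longrightarrow> count_list (tl w) v \<le> 1"
  shows "\<exists>w'. successively (\<lambda>u v. (u, v) \<in> E) w' \<and> hd w' = last w' \<and> set w' = V \<and>
    (\<forall>v. count_list (tl w') v \<le> 2)"
  using assms(4-)
proof (induction "card R" arbitrary: R w rule: less_induct)
  case less
  note R = \<open>R \<subseteq> V\<close>
  have finR: "finite R" using R assms(1) finite_subset by blast
  have finN: "finite (E `` X)" for X
    using assms(3) by (intro finite_subset[OF _ assms(1)]) auto
  show ?case
  proof (cases "R = {}")
    case True
    then show ?thesis using less.prems by auto
  next
    case False
    \<comment> \<open>Admitting the empty set guarantees that a bad set of maximal size
      exists.\<close>
    define bad where "bad X \<longleftrightarrow> X \<subseteq> R \<and> (X = {} \<or> card (E `` X - R) < card X)" for X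
    have "\<exists>X. bad X \<and> (\<forall>Y. bad Y \<longrightarrow> card Y \<le> card X)"
      by (rule ex_has_greatest_nat[of bad "{}" card "Suc (card R)"])
        (auto simp: bad_def finR less_Suc_eq_le intro: card_mono)
    then obtain X where X: "bad X" and max: "\<And>Y. bad Y \<Longrightarrow> card Y \<le> card X" by blast
    have XR: "X \<subseteq> R" and Xle: "card (E `` X - R) \<le> card X" using X by (auto simp: bad_def)
    have finX: "finite X" using XR finR finite_subset by blast
    \<comment> \<open>The expansion hypothesis applied to \<open>R\<close> itself shows that
      \<open>R\<close> is not bad, so passing from \<open>R\<close> to \<open>X\<close> is a genuine
      descent.\<close>
    have "X \<noteq> R" using less.prems(2)[of R] False X by (auto simp: bad_def)
    then have small: "card X < card R" using XR finR by (simp add: psubset_card_mono psubsetI)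
    define Z where "Z = R - X"
    define S where "S z = E `` {z} - R - E `` X" for z
    have "\<exists>f. inj_on f Z \<and> (\<forall>z\<in>Z. f z \<in> S z)"
    proof (rule hall_marriage)
      show "finite Z" using finR by (simp add: Z_def)
      show "finite (S z)" for z using finN by (simp add: S_def)
      fix Y assume Y: "Y \<subseteq> Z"
      show "card Y \<le> card (\<Union>y\<in>Y. S y)"
      proof (rule ccontr)
        \<comment> \<open>A violator \<open>Y\<close> would make \<open>X \<union> Y\<close> bad:
          its neighbours outside \<open>R\<close> are those of \<open>X\<close> together with the
          sets \<open>S y\<close>. It would also be larger than \<open>X\<close>, against
          maximality.\<close>
        assume *: "\<not> ?thesis"
        have finY: "finite Y" using Y finR by (auto simp: Z_def intro: finite_subset)
        have cXY: "card (X \<union> Y) = card X + card Y"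
          using finX finY Y by (intro card_Un_disjoint) (auto simp: Z_def)
        have sub: "E `` (X \<union> Y) - R = (E `` X - R) \<union> (\<Union>y\<in>Y. S y)"
          by (auto simp: S_def)
        have "card (E `` (X \<union> Y) - R) \<le> card (E `` X - R) + card (\<Union>y\<in>Y. S y)"
          unfolding sub by (rule card_Un_le)
        then have "bad (X \<union> Y)" using * Xle cXY XR Y by (auto simp: bad_def Z_def)
        then show False using max[of "X \<union> Y"] cXY * by simp
      qed
    qed
    then obtain f where f: "inj_on f Z" "\<And>z. z \<in> Z \<Longrightarrow> f z \<in> S z" by blast
    have fE: "(z, f z) \<in> E" "f z \<notin> R" "f z \<notin> E `` X" if "z \<in> Z" for z
      using f(2)[OF that] by (auto simp: S_def)
    have "\<exists>w'. successively (\<lambda>u v. (u, v) \<in> E) w' \<and> hd w' = last w' \<and> set w' = set w \<union> Z \<and>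
      (\<forall>v. count_list (tl w') v = count_list (tl w) v + (if v \<in> f ` Z then 1 else 0) + (if v \<in> Z then 1 else 0))"
    proof (rule attach_leaves)
      show "finite Z" using finR by (simp add: Z_def)
      show "f ` Z \<subseteq> set w" using subsetD[OF assms(3), OF fE(1)] fE(2) less.prems(5) by auto
      show "(f z, z) \<in> E \<and> (z, f z) \<in> E" if "z \<in> Z" for z
        using fE(1)[OF that] symD[OF assms(2)] by blast
    qed (use less.prems f(1) in auto)
    then obtain w' where w': "successively (\<lambda>u v. (u, v) \<in> E) w'" "hd w' = last w'" "set w' = set w \<union> Z"
      "\<And>v. count_list (tl w') v = count_list (tl w) v + (if v \<in> f ` Z then 1 else 0) + (if v \<in> Z then 1 else 0)"
      by blast
    have Z0: "count_list (tl w) v = 0" if "v \<in> R" for v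
      using that less.prems(5) by (metis DiffD2 count_list_0_iff list.sel(2) list.set_sel(2))
    have fZ1: "count_list (tl w) v \<le> 1" "v \<notin> R" if v: "v \<in> f ` Z" for v
    proof -
      obtain z where z: "z \<in> Z" "v = f z" using v by blast
      then have "v \<in> E `` R - R" using fE[OF z(1)] by (auto simp: Z_def)
      then show "count_list (tl w) v \<le> 1" "v \<notin> R" using less.prems(7) by auto
    qed
    show ?thesis
    proof (rule less.hyps[OF small])
      show "set w' = V - X" using w'(3) less.prems(5) XR R by (auto simp: Z_def)
      show "count_list (tl w') v \<le> 2" for v
        using w'(4)[of v] Z0[of v] fZ1[of v] less.prems(6)[of v] by (auto simp: Z_def)
      show "count_list (tl w') v \<le> 1" if v: "v \<in> E `` X - X" for v
      proof (cases "v \<in> R")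
        case True
        then show ?thesis using w'(4)[of v] Z0[of v] fZ1(2)[of v] by auto
      next
        case False
        then have "v \<in> E `` R - R" using v XR by auto
        moreover have "v \<notin> f ` Z" using v fE(3) by blast
        ultimately show ?thesis using w'(4)[of v] less.prems(7) False by (auto simp: Z_def)
      qed
    qed (use less.prems XR R w' in auto)
  qed
qed

text \<open>
  The states of a depth-first search: \<open>P\<close> is the stack and \<open>W\<close> the set of finished vertices. Every step
  of the search increases \<open>2 |W| + |P|\<close> by one, so a state maximising it with \<open>|W|\<close> at most the number
  of unvisited vertices attains equality.
\<close>
lemma depth_first_path:
  assumes "finite V" "sym E"
  shows "\<exists>P W. distinct P \<and> successively (\<lambda>u v. (u, v) \<in> E) P \<and> set P \<subseteq> V \<and> W \<subseteq> V - set P \<and>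
    (\<forall>x\<in>W. \<forall>y\<in>V - set P - W. (x, y) \<notin> E) \<and> card W = card (V - set P - W)"
proof -
  define st where "st = (\<lambda>(P, W). distinct P \<and> successively (\<lambda>u v. (u, v) \<in> E) P \<and> set P \<subseteq> V \<and>
    W \<subseteq> V - set P \<and> (\<forall>x\<in>W. \<forall>y\<in>V - set P - W. (x, y) \<notin> E) \<and> card W \<le> card (V - set P - W))"
  define m :: "'a list \<times> 'a set \<Rightarrow> nat" where "m = (\<lambda>(P, W). 2 * card W + length P)"
  have "m s \<le> 3 * card V" if "st s" for s
  proof -
    obtain P W where s: "s = (P, W)" by (cases s)
    have "card W \<le> card V" "length P \<le> card V"
      using that assms(1) by (auto simp: st_def s distinct_card[symmetric] intro!: card_mono)
    then show ?thesis by (simp add: m_def s)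
  qed
  moreover have "st ([], {})" by (simp add: st_def)
  ultimately have "\<exists>s. st s \<and> (\<forall>t. st t \<longrightarrow> m t \<le> m s)"
    by (intro ex_has_greatest_nat[of st _ m "Suc (3 * card V)"]) (auto simp: less_Suc_eq_le)
  then obtain P W where s: "st (P, W)" and max: "\<And>t. st t \<Longrightarrow> m t \<le> m (P, W)" by auto
  define U where "U = V - set P - W"
  have P: "distinct P" "successively (\<lambda>u v. (u, v) \<in> E) P" "set P \<subseteq> V" "W \<subseteq> V - set P"
    and WU: "\<And>x y. x \<in> W \<Longrightarrow> y \<in> U \<Longrightarrow> (x, y) \<notin> E" and le: "card W \<le> card U"
    using s by (auto simp: st_def U_def)
  have finU: "finite U" using assms(1) by (simp add: U_def)
  have finW: "finite W" using assms(1) P(4) by (meson finite_Diff finite_subset)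
  have "card W = card U"
  proof (rule ccontr)
    assume "card W \<noteq> card U"
    then have lt: "card W < card U" using le by simp
    \<comment> \<open>Pushing \<open>u\<close> would raise \<open>m\<close> by one; the strict
      inequality \<open>lt\<close> leaves room for the loss of \<open>u\<close> from
      \<open>U\<close>.\<close>
    have no_ext: "\<not> successively (\<lambda>u v. (u, v) \<in> E) (u # P)" if u: "u \<in> U" for u
    proof
      assume *: "successively (\<lambda>u v. (u, v) \<in> E) (u # P)"
      have eq: "V - set (u # P) - W = U - {u}" by (auto simp: U_def)
      have "st (u # P, W)"
        unfolding st_def prod.case eq using * u P lt WU finU
        by (auto simp: U_def[symmetric] card_Diff_singleton_if) (auto simp: U_def)
      then show False using max[of "(u # P, W)"] by (simp add: m_def)
    qed
    obtain u where u: "u \<in> U" using lt by (metis card.empty equals0I not_less_zero)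
    \<comment> \<open>An empty stack could always be extended by \<open>u\<close>, so there is a top
      vertex \<open>v\<close>. Declaring it finished costs one in \<open>length P\<close> and gains
      two in \<open>2 * card W\<close>.\<close>
    obtain v Q where PQ: "P = v # Q" using no_ext[OF u] by (cases P) auto
    have vU: "(v, y) \<notin> E" if "y \<in> U" for y
      using no_ext[OF that] P(2) assms(2) unfolding PQ by (auto simp: successively_Cons dest: symD)
    have eq: "V - set Q - insert v W = U" using P(1) by (auto simp: U_def PQ)
    have "v \<notin> W" using P(4) by (auto simp: PQ)
    then have c: "card (insert v W) = Suc (card W)" using finW by simp
    have "st (Q, insert v W)"
      unfolding st_def prod.case eq c using P lt WU vU
      by (auto simp: PQ successively_Cons)
    then show False using max[of "(Q, insert v W)"] c by (simp add: m_def PQ)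
  qed
  then show ?thesis using P WU by (intro exI[of _ P] exI[of _ W]) (auto simp: U_def)
qed

text \<open>The purely combinatorial half: the spectrum enters only through the inequality
  \<open>sep\<close>.\<close>

lemma expander_two_walk:
  assumes fin: "finite V" and E: "sym E" "E \<subseteq> V \<times> V" and two: "2 \<le> card V"
    and sep: "\<And>X Y. X \<subseteq> V \<Longrightarrow> Y \<subseteq> V \<Longrightarrow> X \<inter> Y = {} \<Longrightarrow> (\<And>x y. x \<in> X \<Longrightarrow> y \<in> Y \<Longrightarrow> (x, y) \<notin> E) \<Longrightarrow>
      81 * (real (card X) * real (card Y)) \<le> (card V - real (card X)) * (card V - real (card Y))"
  shows "\<exists>w. successively (\<lambda>u v. (u, v) \<in> E) w \<and> 2 \<le> length w \<and> hd w = last w \<and> set w = V \<and>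
    (\<forall>v. count_list (tl w) v \<le> 2)"
proof -
  define n where "n = card V"
  define d where "d = n div 10"
  \<comment> \<open>For two sets of common size \<open>k\<close> the inequality is one between
    squares, \<open>9 k \<le> n - k\<close>.\<close>
  have squares: "10 * k \<le> n" if "81 * (real k * real k) \<le> (n - real k) * (n - real k)" "k \<le> n" for k
  proof -
    have "(9 * real k)\<^sup>2 = 81 * (real k * real k)" by (simp add: power2_eq_square)
    then have "(9 * real k)\<^sup>2 \<le> (n - real k)\<^sup>2"
      using that(1) unfolding power2_eq_square[of "n - real k"] by (rule ord_eq_le_trans)
    then have "9 * real k \<le> n - real k" by (rule power2_le_imp_le) (use that(2) in simp)
    then show ?thesis by linarith
  qed
  obtain P W where P: "distinct P" "successively (\<lambda>u v. (u, v) \<in> E) P" "set P \<subseteq> V" "W \<subseteq> V - set P"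
    and WU: "\<forall>x\<in>W. \<forall>y\<in>V - set P - W. (x, y) \<notin> E" and ceq: "card W = card (V - set P - W)"
    using depth_first_path[OF fin E(1)] by (elim exE conjE)
  have finW: "finite W" using P(4) fin by (meson finite_Diff finite_subset)
  have Wn: "card W \<le> n" unfolding n_def using P(4) fin by (intro card_mono) auto
  have "card (V - set P) = n - length P"
    using P(1,3) by (simp add: card_Diff_subset distinct_card n_def)
  moreover have "card (V - set P - W) = card (V - set P) - card W"
    using P(4) finW by (intro card_Diff_subset) auto
  moreover have "card W \<le> card (V - set P)" using P(4) fin by (intro card_mono) auto
  moreover have "length P \<le> n" using P(1,3) fin by (metis card_mono distinct_card n_def)
  ultimately have len: "length P + 2 * card W = n" using ceq by linarith
  have "81 * (real (card W) * real (card W)) \<le> (n - real (card W)) * (n - real (card W))"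
    using sep[of W "V - set P - W"] P(4) WU unfolding ceq[symmetric] n_def by auto
  from squares[OF this Wn] have Wd: "card W \<le> d" by (simp add: d_def)
  \<comment> \<open>The least size that two disjoint non-adjacent sets cannot both have, since
    \<open>10 * k > n\<close>.\<close>
  define k where "k = d + 1"
  have dn: "10 * d \<le> n" by (simp add: d_def)
  \<comment> \<open>Here \<open>length P \<ge> n - 2 * d \<ge> 8 * d\<close>, which suffices for
    \<open>d \<ge> 1\<close>; for \<open>d = 0\<close> the assumption \<open>n \<ge> 2\<close> is
    what counts.\<close>
  have k: "2 * k \<le> length P"
    using len Wd two dn unfolding k_def n_def[symmetric] by (cases d) auto
  define A where "A = set (take k P)"
  define B where "B = set (drop (length P - k) P)"
  have cA: "card A = k" using P(1) k by (simp add: A_def distinct_card)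
  have cB: "card B = k" using P(1) k by (simp add: B_def distinct_card)
  have "A \<inter> B = {}"
    unfolding A_def B_def using k by (intro set_take_disj_set_drop_if_distinct P(1)) auto
  moreover have "A \<subseteq> V" "B \<subseteq> V" using P(3) by (auto simp: A_def B_def dest: in_set_takeD in_set_dropD)
  moreover have "\<not> 10 * k \<le> n" unfolding k_def d_def by presburger
  moreover have "k \<le> n" using k len by linarith
  ultimately have "\<exists>x\<in>A. \<exists>y\<in>B. (x, y) \<in> E"
    using sep[of A B] squares[of k] unfolding cA cB n_def by blast
  then obtain i j where ij: "i < k" "j < k" "(P ! i, P ! (length P - k + j)) \<in> E"
    using k unfolding A_def B_def by (auto simp: in_set_conv_nth)
  define j' where "j' = length P - k + j"
  have j': "i < j'" "j' < length P" "(P ! i, P ! j') \<in> E" "length P - k \<le> j'"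
    using ij k by (auto simp: j'_def)
  define Q where "Q = drop i (take (Suc j') P)"
  have lQ: "length Q = Suc j' - i" using j' by (simp add: Q_def)
  have Qne: "Q \<noteq> []" using lQ j' by auto
  have hdQ: "hd Q = P ! i" using j' by (simp add: Q_def hd_drop_conv_nth)
  have lastQ: "last Q = P ! j'" using j' by (simp add: Q_def last_conv_nth)
  have dQ: "distinct Q" using P(1) by (simp add: Q_def)
  have sQ: "successively (\<lambda>u v. (u, v) \<in> E) Q"
  proof -
    have "P = take i P @ Q @ drop (Suc j') P"
      unfolding Q_def using j' by (metis append.assoc append_take_drop_id less_imp_le_nat less_SucI min.absorb1 take_take)
    then show ?thesis using P(2) by (metis successively_append_iff)
  qed
  define R where "R = V - set Q"
  have QV: "set Q \<subseteq> V" using P(3) by (auto simp: Q_def dest: in_set_takeD in_set_dropD)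
  have cR: "card R + length Q = n"
    using QV dQ fin by (metis R_def card_Diff_subset card_mono distinct_card finite_set le_add_diff_inverse2 n_def)
  \<comment> \<open>At most \<open>d\<close> vertices are cut off at each end of \<open>P\<close>,
    and at most \<open>2 * d\<close> lie off \<open>P\<close>, so
    \<open>card R \<le> 4 * d\<close>.\<close>
  have R: "5 * card R \<le> 2 * n"
    using cR lQ j' ij(1) k len Wd dn unfolding k_def by linarith
  define w where "w = Q @ [hd Q]"
  have "\<exists>w'. successively (\<lambda>u v. (u, v) \<in> E) w' \<and> hd w' = last w' \<and> set w' = V \<and>
    (\<forall>v. count_list (tl w') v \<le> 2)"
  proof (rule absorb_into_closed_walk[OF fin E])
    show "R \<subseteq> V" by (auto simp: R_def)
    fix X assume X: "X \<subseteq> R" "X \<noteq> {}"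
    show "card X \<le> card (E `` X - X)"
    proof (rule ccontr)
      assume *: "\<not> ?thesis"
      \<comment> \<open>\<open>Y\<close> collects the vertices outside \<open>X\<close> not adjacent
        to it. Fewer than \<open>card X\<close> neighbours would give
        \<open>n - card Y < 2 * card X\<close>, so \<open>sep\<close> yields
        \<open>81 * card Y \<le> 2 * n\<close>; but \<open>card X \<le> 2 * n / 5\<close> forces
        \<open>card Y > n / 5\<close>.\<close>
      define Y where "Y = V - X - (E `` X - X)"
      have XV: "X \<subseteq> V" using X(1) by (auto simp: R_def)
      have finX: "finite X" using XV fin finite_subset by blast
      have "card X \<le> card R" using X(1) fin by (intro card_mono) (auto simp: R_def)
      have X0: "card X > 0" using X(2) finX by (simp add: card_gt_0_iff)
      have NV: "E `` X - X \<subseteq> V - X" using E(2) by auto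
      have "card Y = card (V - X) - card (E `` X - X)"
        unfolding Y_def using NV fin by (intro card_Diff_subset) (auto intro: finite_subset)
      moreover have "card (V - X) = n - card X"
        unfolding n_def using XV finX by (intro card_Diff_subset) auto
      ultimately have cY: "card Y + 2 * card X \<ge> n + 1" using * by linarith
      have YV: "Y \<subseteq> V" by (auto simp: Y_def)
      have "card Y \<le> n" unfolding n_def using YV fin by (intro card_mono)
      have "81 * (real (card X) * real (card Y)) \<le> (n - real (card X)) * (n - real (card Y))"
        unfolding n_def using XV YV by (intro sep) (auto simp: Y_def)
      also have "\<dots> \<le> n * (2 * real (card X))"
        using cY \<open>card Y \<le> n\<close> \<open>card X \<le> card R\<close> R by (intro mult_mono) auto
      finally have "81 * real (card Y) \<le> 2 * n" using X0 by (simp add: field_simps)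
      then show False using cY \<open>card X \<le> card R\<close> R by linarith
    qed
  next
    show "successively (\<lambda>u v. (u, v) \<in> E) w"
      using sQ Qne j'(3) E(1) by (auto simp: w_def successively_append_iff hdQ lastQ dest: symD)
    show "hd w = last w" using Qne by (simp add: w_def)
    show "set w = V - R" using QV Qne by (auto simp: w_def R_def)
    have "distinct (tl w)" using dQ Qne by (cases Q) (auto simp: w_def)
    then have simple: "count_list (tl w) v \<le> 1" for v by (rule count_list_distinct_le)
    then show "count_list (tl w) v \<le> 1" for v .
    show "count_list (tl w) v \<le> 2" for v using simple[of v] by simp
  qed
  then obtain w' where w': "successively (\<lambda>u v. (u, v) \<in> E) w'" "hd w' = last w'" "set w' = V"
    "\<And>v. count_list (tl w') v \<le> 2" by blast
  moreover have "2 \<le> length w'"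
    using two w'(3) by (metis card_length order_trans)
  ultimately show ?thesis by blast
qed

section \<open>From vertex lists to walks of arcs\<close>

lemma awalk_of_vertex_list:
  assumes "w \<noteq> []"
  shows "pawalk_verts (hd w) (zip w (tl w)) = w" "pcas (hd w) (zip w (tl w)) (last w)"
  using assms by (induction w rule: induct_list012) auto

lemma successively_zip_tl: "successively R w \<Longrightarrow> (u, v) \<in> set (zip w (tl w)) \<Longrightarrow> R u v"
  by (induction R w rule: successively.induct) auto

lemma is_k_walk_of_vertex_list:
  assumes "successively (\<lambda>u v. (u, v) \<in> parcs G) w" "2 \<le> length w" "hd w = last w" "set w = pverts G"
    "\<And>v. count_list (tl w) v \<le> k"
  shows "is_k_walk k G (hd w) (zip w (tl w))"
proof -
  \<comment> \<open>A nonempty arc list puts \<open>closed_walk_visits\<close> in its main case,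
    where it equals \<open>tl w\<close>.\<close>
  have "w \<noteq> []" "zip w (tl w) \<noteq> []" using assms(2) by (cases w; cases "tl w"; auto)+
  then show ?thesis
    using awalk_of_vertex_list[of w] successively_zip_tl[OF assms(1)] assms
    by (auto simp: is_k_walk_def closed_walk_visits_def pre_digraph.awalk_def
        cas_with_proj_eq awalk_verts_with_proj_eq dest: hd_in_set)
qed

section \<open>Rayleigh bounds for symmetric matrices\<close>

text \<open>A continuous form attains its minimum on the compact unit sphere of the subspace cut out
  by the constraints, and homogeneity carries the bound to all of that subspace. The vector
  \<open>g\<close> witnesses that the sphere is nonempty.\<close>

lemma rayleigh_minimizer_exists:
  fixes a :: "nat \<Rightarrow> nat \<Rightarrow> real" and v :: "nat \<Rightarrow> nat \<Rightarrow> real"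
  assumes "\<exists>i<n. g i \<noteq> 0" and "\<forall>j<k. (\<Sum>i<n. v j i * g i) = 0"
  shows "\<exists>u. (\<Sum>i<n. (u i)\<^sup>2) = 1 \<and> (\<forall>j<k. (\<Sum>i<n. v j i * u i) = 0) \<and>
    (\<forall>h. (\<forall>j<k. (\<Sum>i<n. v j i * h i) = 0) \<longrightarrow>
      (\<Sum>i<n. \<Sum>j<n. a i j * u i * u j) * (\<Sum>i<n. (h i)\<^sup>2) \<le> (\<Sum>i<n. \<Sum>j<n. a i j * h i * h j))"
proof -
  define q where "q f = (\<Sum>i<n. \<Sum>j<n. a i j * f i * f j)" for f :: "nat \<Rightarrow> real"
  define N where "N f = (\<Sum>i<n. (f i)\<^sup>2)" for f :: "nat \<Rightarrow> real"
  define U where "U = {f. \<forall>j<k. (\<Sum>i<n. v j i * f i) = 0}"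
  \<comment> \<open>Vectors are functions on all of \<open>nat\<close>. Pinning the coordinates from
    \<open>n\<close> on to 0 gives a product of compact sets, compact by Tychonoff's
    theorem.\<close>
  define K :: "(nat \<Rightarrow> real) set" where "K = (\<Pi>\<^sub>E i\<in>UNIV. if i < n then {-1..1} else {0})"
  define S where "S = K \<inter> (U \<inter> {f. N f = 1})"
  have compact_K: "compact K"
  proof -
    have "compactin (product_topology (\<lambda>i. euclidean) UNIV) K"
      unfolding K_def compactin_PiE by auto
    then show ?thesis by (simp add: euclidean_product_topology)
  qed
  have cont: "continuous_on UNIV (\<lambda>f :: nat \<Rightarrow> real. f i)" for i by simp
  have "closed {f. N f = 1}"
    unfolding N_def by (intro closed_Collect_eq continuous_intros cont)
  moreover have "closed U"
    unfolding U_def by (intro closed_Collect_all closed_Collect_imp closed_Collect_eq continuous_intros cont) auto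
  ultimately have "compact S"
    unfolding S_def by (intro compact_Int_closed compact_K closed_Int)
  have pos: "N f > 0" if f: "\<exists>i<n. f i \<noteq> 0" for f
  proof -
    obtain i where "i < n" "f i \<noteq> 0" using f by blast
    then show ?thesis unfolding N_def by (intro sum_pos2[of _ i]) auto
  qed
  define nf where "nf f = (\<lambda>i. if i < n then f i / sqrt (N f) else 0)" for f
  have nf: "nf f \<in> S" if "f \<in> U" "N f > 0" for f
  proof -
    have "(\<Sum>i<n. v j i * nf f i) = (\<Sum>i<n. v j i * f i) / sqrt (N f)" for j
      unfolding nf_def sum_divide_distrib by (intro sum.cong) auto
    then have U: "nf f \<in> U" using that(1) by (auto simp: U_def)
    have "N (nf f) = (\<Sum>i<n. (f i)\<^sup>2 / N f)"
      unfolding N_def[of "nf f"] using that(2) by (intro sum.cong) (auto simp: nf_def power_divide)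
    then have N1: "N (nf f) = 1" using that(2) by (simp add: sum_divide_distrib[symmetric] N_def[symmetric])
    have "(nf f i)\<^sup>2 \<le> 1" if "i < n" for i
      using N1 that member_le_sum[of i "{..<n}" "\<lambda>i. (nf f i)\<^sup>2"] by (simp add: N_def)
    then have "\<bar>nf f i\<bar> \<le> 1" if "i < n" for i using that by (simp add: abs_square_le_1)
    moreover have "nf f i = 0" if "\<not> i < n" for i using that by (simp add: nf_def)
    ultimately have "nf f \<in> K" by (simp add: K_def PiE_iff abs_le_iff minus_le_iff)
    then show ?thesis using U N1 by (auto simp: S_def)
  qed
  have qnf: "q (nf f) = q f / N f" if "N f > 0" for f
  proof -
    have "q (nf f) = (\<Sum>i<n. \<Sum>j<n. a i j * f i * f j / N f)"
      unfolding q_def using that by (intro sum.cong) (auto simp: nf_def)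
    then show ?thesis by (simp add: q_def sum_divide_distrib)
  qed
  have "S \<noteq> {}" using nf[of g] pos[of g] assms by (auto simp: U_def)
  moreover have "continuous_on S q"
    unfolding q_def by (rule continuous_on_subset[of UNIV]) (intro continuous_intros cont, simp)
  ultimately obtain u where u: "u \<in> S" and min: "\<And>f. f \<in> S \<Longrightarrow> q u \<le> q f"
    using continuous_attains_inf[OF \<open>compact S\<close>] by blast
  have "q u * N h \<le> q h" if "h \<in> U" for h
  proof (cases "\<exists>i<n. h i \<noteq> 0")
    case True
    then show ?thesis using min[OF nf[OF that pos]] qnf[OF pos] pos[of h] by (simp add: field_simps)
  next
    case False
    then show ?thesis by (simp add: q_def N_def)
  qed
  then show ?thesis using u by (intro exI[of _ u]) (auto simp: S_def U_def q_def N_def)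
qed

lemma linear_coefficient_zero:
  fixes \<beta> \<gamma> :: real
  assumes "\<And>t. 0 \<le> 2 * t * \<beta> + t\<^sup>2 * \<gamma>"
  shows "\<beta> = 0"
proof (rule ccontr)
  assume "\<beta> \<noteq> 0"
  \<comment> \<open>This \<open>s\<close> is small enough for either sign of
    \<open>\<gamma>\<close>: at \<open>t = - s * \<beta>\<close> the linear term dominates and the
    value is negative.\<close>
  define s where "s = 1 / (\<bar>\<gamma>\<bar> + 1)"
  have s: "0 < s" "s * \<gamma> < 1" by (auto simp: s_def field_simps)
  have "2 * (- (s * \<beta>)) * \<beta> + (- (s * \<beta>))\<^sup>2 * \<gamma> = s * \<beta>\<^sup>2 * (s * \<gamma> - 2)"
    by (simp add: algebra_simps power2_eq_square)
  moreover have "s * \<beta>\<^sup>2 * (s * \<gamma> - 2) < 0"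
    using s \<open>\<beta> \<noteq> 0\<close> by (intro mult_pos_neg mult_pos_pos) auto
  ultimately show False using assms[of "- (s * \<beta>)"] by linarith
qed

text \<open>A minimiser \<open>u\<close> of the quadratic form on the unit sphere of the orthogonal
  complement is an eigenvector: its residual \<open>w\<close> stays in the complement by symmetry,
  so \<open>u\<close> may be varied along \<open>w\<close>, and the first-order condition reads
  \<open>w = 0\<close>.\<close>

lemma symmetric_eigenvector_orthogonal:
  fixes a :: "nat \<Rightarrow> nat \<Rightarrow> real"
  assumes sym: "\<And>i j. i < n \<Longrightarrow> j < n \<Longrightarrow> a i j = a j i" and "k < n"
    and orth: "\<And>j l. j < k \<Longrightarrow> l < k \<Longrightarrow> (\<Sum>i<n. v j i * v l i) = (if j = l then 1 else 0)"
    and eig: "\<And>j i. j < k \<Longrightarrow> i < n \<Longrightarrow> (\<Sum>m<n. a i m * v j m) = e j * v j i"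
  shows "\<exists>u \<theta>. (\<Sum>i<n. u i * u i) = 1 \<and> (\<forall>j<k. (\<Sum>i<n. v j i * u i) = 0) \<and>
    (\<forall>i<n. (\<Sum>m<n. a i m * u m) = \<theta> * u i)"
proof -
  \<comment> \<open>\<open>g i\<close> is the projection of the \<open>i\<close>-th unit vector to the complement; the trace \<open>n - k\<close> of the
    projection shows that not all of them vanish.\<close>
  define g where "g i m = (if m = i then 1 else 0) - (\<Sum>j<k. v j i * v j m)" for i m
  have g_orth: "(\<Sum>m<n. v l m * g i m) = 0" if "l < k" "i < n" for l i
  proof -
    have "(\<Sum>m<n. v l m * g i m) = (\<Sum>m<n. v l m * (if m = i then 1 else 0)) - (\<Sum>m<n. \<Sum>j<k. v j i * (v l m * v j m))"
      unfolding g_def by (simp add: right_diff_distrib sum_subtractf sum_distrib_left mult_ac)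
    also have "(\<Sum>m<n. \<Sum>j<k. v j i * (v l m * v j m)) = (\<Sum>j<k. v j i * (\<Sum>m<n. v l m * v j m))"
      by (subst sum.swap) (simp add: sum_distrib_left)
    also have "\<dots> = (\<Sum>j<k. v j i * (if l = j then 1 else 0))"
      using orth that by (intro sum.cong) auto
    finally show ?thesis using that by (simp add: if_distrib cong: if_cong)
  qed
  have "\<exists>i<n. \<exists>m<n. g i m \<noteq> 0"
  proof (rule ccontr)
    assume "\<not> ?thesis"
    then have "(\<Sum>i<n. g i i) = 0" by auto
    moreover have "(\<Sum>i<n. \<Sum>j<k. v j i * v j i) = (\<Sum>j<k. 1)"
      by (subst sum.swap) (auto simp: orth intro: sum.cong)
    ultimately have "real n = real k" by (simp add: g_def sum_subtractf)
    then show False using \<open>k < n\<close> by simp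
  qed
  then obtain i where i: "i < n" "\<exists>m<n. g i m \<noteq> 0" by blast
  obtain u where u: "(\<Sum>i<n. (u i)\<^sup>2) = 1" and uU: "\<forall>j<k. (\<Sum>i<n. v j i * u i) = 0"
    and min: "\<And>h. \<forall>j<k. (\<Sum>i<n. v j i * h i) = 0 \<Longrightarrow>
      (\<Sum>i<n. \<Sum>j<n. a i j * u i * u j) * (\<Sum>i<n. (h i)\<^sup>2) \<le> (\<Sum>i<n. \<Sum>j<n. a i j * h i * h j)"
    using rayleigh_minimizer_exists[of n "g i" k v a] i g_orth by blast
  define \<theta> where "\<theta> = (\<Sum>i<n. \<Sum>j<n. a i j * u i * u j)"
  define w where "w i = (\<Sum>m<n. a i m * u m) - \<theta> * u i" for i
  have Au: "w i + \<theta> * u i = (\<Sum>m<n. a i m * u m)" for i by (simp add: w_def)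
  have "(\<Sum>i<n. v j i * w i) = 0" if "j < k" for j
  proof -
    have "(\<Sum>i<n. v j i * w i) = (\<Sum>i<n. \<Sum>m<n. v j i * (a i m * u m)) - \<theta> * (\<Sum>i<n. v j i * u i)"
      unfolding w_def by (simp add: right_diff_distrib sum_subtractf sum_distrib_left mult_ac)
    also have "(\<Sum>i<n. \<Sum>m<n. v j i * (a i m * u m)) = (\<Sum>m<n. u m * (\<Sum>i<n. a m i * v j i))"
      unfolding sum_distrib_left by (subst sum.swap) (auto intro!: sum.cong simp: sym)
    also have "\<dots> = (\<Sum>m<n. e j * (v j m * u m))"
      using that by (intro sum.cong) (auto simp: eig)
    finally show ?thesis using uU that by (simp add: sum_distrib_left[symmetric])
  qed
  then have wU: "\<forall>j<k. (\<Sum>i<n. v j i * w i) = 0" by blast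
  have "(\<Sum>i<n. w i * w i) = 0"
  proof (rule linear_coefficient_zero)
    fix t :: real
    \<comment> \<open>The bound along the line \<open>u + t * w\<close> has linear coefficient
      \<open>2 * (\<Sum>i<n. w i * w i)\<close>, because the two mixed terms agree by
      symmetry.\<close>
    define h where "h i = u i + t * w i" for i
    have "\<forall>j<k. (\<Sum>i<n. v j i * h i) = 0"
      using wU uU by (simp add: h_def distrib_left sum.distrib mult.left_commute[of _ t] sum_distrib_left[symmetric])
    from min[OF this] have le: "\<theta> * (\<Sum>i<n. (h i)\<^sup>2) \<le> (\<Sum>i<n. \<Sum>j<n. a i j * h i * h j)"
      by (simp add: \<theta>_def)
    have 1: "(\<Sum>i<n. (h i)\<^sup>2) = 1 + 2 * t * (\<Sum>i<n. u i * w i) + t\<^sup>2 * (\<Sum>i<n. (w i)\<^sup>2)"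
      unfolding h_def u[symmetric]
      by (simp add: power2_sum power_mult_distrib sum.distrib sum_distrib_left mult_ac)
    have "(\<Sum>i<n. \<Sum>j<n. a i j * h i * h j) = \<theta> + t * (\<Sum>i<n. \<Sum>j<n. a i j * w i * u j)
        + t * (\<Sum>i<n. \<Sum>j<n. a i j * u i * w j) + t\<^sup>2 * (\<Sum>i<n. \<Sum>j<n. a i j * w i * w j)"
      unfolding h_def \<theta>_def sum_distrib_left sum.distrib[symmetric]
      by (intro sum.cong refl) (simp add: algebra_simps power2_eq_square)
    also have "(\<Sum>i<n. \<Sum>j<n. a i j * u i * w j) = (\<Sum>i<n. \<Sum>j<n. a i j * w i * u j)"
      by (subst sum.swap) (auto intro!: sum.cong simp: sym)
    also have "(\<Sum>i<n. \<Sum>j<n. a i j * w i * u j) = (\<Sum>i<n. w i * (w i + \<theta> * u i))"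
      by (simp add: Au sum_distrib_left mult_ac)
    also have "\<dots> = (\<Sum>i<n. w i * w i) + \<theta> * (\<Sum>i<n. u i * w i)"
      by (simp add: distrib_left sum.distrib sum_distrib_left mult_ac)
    finally show "0 \<le> 2 * t * (\<Sum>i<n. w i * w i) +
        t\<^sup>2 * ((\<Sum>i<n. \<Sum>j<n. a i j * w i * w j) - \<theta> * (\<Sum>i<n. (w i)\<^sup>2))"
      using le unfolding 1 by (simp add: algebra_simps)
  qed
  then have "\<forall>i<n. w i = 0" by (subst (asm) sum_nonneg_eq_0_iff) auto
  then show ?thesis
    using u uU by (intro exI[of _ u] exI[of _ \<theta>]) (auto simp: w_def power2_eq_square)
qed

text \<open>The basis starts from a prescribed eigenvector, so that orthogonality to it later
  removes a known coefficient.\<close>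

lemma symmetric_eigenbasis:
  fixes a :: "nat \<Rightarrow> nat \<Rightarrow> real"
  assumes sym: "\<And>i j. i < n \<Longrightarrow> j < n \<Longrightarrow> a i j = a j i"
    and unit: "(\<Sum>i<n. u i * u i) = 1" and eig: "\<And>i. i < n \<Longrightarrow> (\<Sum>m<n. a i m * u m) = \<mu> * u i"
    and k: "1 \<le> k" "k \<le> n"
  shows "\<exists>v e. v 0 = u \<and> e 0 = \<mu> \<and>
    (\<forall>j<k. \<forall>l<k. (\<Sum>i<n. v j i * v l i) = (if j = l then 1 else 0)) \<and>
    (\<forall>j<k. \<forall>i<n. (\<Sum>m<n. a i m * v j m) = e j * v j i)"
  using k
proof (induction k rule: dec_induct)
  case base
  then show ?case using unit eig by (intro exI[of _ "\<lambda>_. u"] exI[of _ "\<lambda>_. \<mu>"]) auto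
next
  case (step k)
  then obtain v e where ve: "v 0 = u" "e 0 = \<mu>"
    "\<forall>j<k. \<forall>l<k. (\<Sum>i<n. v j i * v l i) = (if j = l then 1 else 0)"
    "\<forall>j<k. \<forall>i<n. (\<Sum>m<n. a i m * v j m) = e j * v j i"
    by auto
  obtain x \<theta> where x: "(\<Sum>i<n. x i * x i) = 1" "\<forall>j<k. (\<Sum>i<n. v j i * x i) = 0"
    "\<forall>i<n. (\<Sum>m<n. a i m * x m) = \<theta> * x i"
    using symmetric_eigenvector_orthogonal[of n a k v e] sym ve(3,4) step.prems by auto
  have "(v(k := x)) 0 = u" "(e(k := \<theta>)) 0 = \<mu>" using ve(1,2) step.hyps by auto
  moreover have "(\<Sum>i<n. (v(k := x)) j i * (v(k := x)) l i) = (if j = l then 1 else 0)"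
    if "j < Suc k" "l < Suc k" for j l
    using ve(3) x(1,2) that by (cases "j = k"; cases "l = k") (simp_all add: less_Suc_eq mult.commute)
  moreover have "(\<Sum>m<n. a i m * (v(k := x)) j m) = (e(k := \<theta>)) j * (v(k := x)) j i"
    if "j < Suc k" "i < n" for j i
    using ve(4) x(3) that by (cases "j = k") (simp_all add: less_Suc_eq)
  ultimately show ?case by blast
qed

section \<open>Ordered eigenvalues and Rayleigh bounds\<close>

lemma proots_linear_factors: "proots (\<Prod>x\<leftarrow>xs. [:- x, 1:]) = mset (xs :: real list)"
proof (induction xs)
  case (Cons x xs)
  have "(\<Prod>x\<leftarrow>xs. [:- x, 1:]) \<noteq> 0" by (auto simp: prod_list_zero_iff)
  then show ?case using Cons by (simp add: proots_mult del: mult_pCons_left)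
qed simp

text \<open>In an orthonormal eigenbasis beginning with \<open>u\<close>, the form becomes a
  weighted sum of squared coefficients of \<open>f\<close>, and the coefficient along
  \<open>u\<close> vanishes. Hypothesis \<open>least\<close> makes \<open>\<mu>\<close> a smallest
  eigenvalue, so the remaining weights lie between \<open>es ! 1\<close> and
  \<open>es ! (n - 1)\<close>.\<close>

lemma rayleigh_bounds:
  fixes A :: "real mat"
  assumes A: "A \<in> carrier_mat n n" and n: "2 \<le> n"
    and sym: "\<And>i j. i < n \<Longrightarrow> j < n \<Longrightarrow> A $$ (i, j) = A $$ (j, i)"
    and unit: "(\<Sum>i<n. u i * u i) = 1" and eig: "\<And>i. i < n \<Longrightarrow> (\<Sum>m<n. A $$ (i, m) * u m) = \<mu> * u i"
    and least: "\<And>f. \<mu> * (\<Sum>i<n. f i * f i) \<le> (\<Sum>i<n. \<Sum>j<n. A $$ (i, j) * f i * f j)"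
    and f: "(\<Sum>i<n. u i * f i) = 0"
  defines "es \<equiv> sorted_list_of_multiset (proots (char_poly A))"
  shows "es ! 1 * (\<Sum>i<n. f i * f i) \<le> (\<Sum>i<n. \<Sum>j<n. A $$ (i, j) * f i * f j)"
    and "(\<Sum>i<n. \<Sum>j<n. A $$ (i, j) * f i * f j) \<le> es ! (n - 1) * (\<Sum>i<n. f i * f i)"
proof -
  obtain v e where v0: "v 0 = u" and e0: "e 0 = \<mu>"
    and orth: "\<And>j l. j < n \<Longrightarrow> l < n \<Longrightarrow> (\<Sum>i<n. v j i * v l i) = (if j = l then 1 else 0)"
    and eigv: "\<And>j i. j < n \<Longrightarrow> i < n \<Longrightarrow> (\<Sum>m<n. A $$ (i, m) * v j m) = e j * v j i"
    using symmetric_eigenbasis[of n "\<lambda>i j. A $$ (i, j)" u \<mu> n] sym unit eig n by auto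
  define P where "P = mat n n (\<lambda>(i, j). v j i)"
  define D where "D = mat n n (\<lambda>(i, j). if i = j then e j else 0)"
  have P: "P \<in> carrier_mat n n" and D: "D \<in> carrier_mat n n" by (auto simp: P_def D_def)
  have PtP: "P\<^sup>T * P = 1\<^sub>m n"
    by (rule eq_matI) (auto simp: P_def scalar_prod_def lessThan_atLeast0[symmetric] orth)
  have PPt: "P * P\<^sup>T = 1\<^sub>m n"
    using mat_mult_left_right_inverse[OF _ P PtP] P by simp
  have "A * P = P * D"
  proof (rule eq_matI)
    fix i j assume "i < dim_row (P * D)" "j < dim_col (P * D)"
    then have ij: "i < n" "j < n" by (auto simp: P_def D_def)
    have "(A * P) $$ (i, j) = (\<Sum>m<n. A $$ (i, m) * v j m)"
      using A ij by (auto simp: P_def scalar_prod_def lessThan_atLeast0 intro!: sum.cong)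
    also have "\<dots> = e j * v j i" using ij by (rule eigv[rotated])
    also have "\<dots> = (P * D) $$ (i, j)"
      using ij by (simp add: P_def D_def scalar_prod_def if_distrib cong: if_cong)
    finally show "(A * P) $$ (i, j) = (P * D) $$ (i, j)" .
  qed (use A in \<open>auto simp: P_def D_def\<close>)
  then have "A * P * P\<^sup>T = P * D * P\<^sup>T" by simp
  then have "A = P * D * P\<^sup>T" using A P PPt by (simp add: assoc_mult_mat[of _ n n _ n _ n])
  then have "similar_mat A D"
    using A P D PPt PtP by (intro similar_matI[of _ _ P "P\<^sup>T" n]) auto
  then have "char_poly A = char_poly D" by (rule char_poly_similar)
  also have "\<dots> = (\<Prod>x\<leftarrow>diag_mat D. [:- x, 1:])"
    by (rule char_poly_upper_triangular[OF D]) (auto simp: upper_triangular_def D_def)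
  also have "diag_mat D = map e [0..<n]" by (auto simp: diag_mat_def D_def)
  \<comment> \<open>Similarity to the diagonal matrix \<open>D\<close> identifies \<open>es\<close>
    with the sorted values of \<open>e\<close>, multiplicities included.\<close>
  finally have es: "es = sort (map e [0..<n])"
    unfolding es_def by (simp only: proots_linear_factors sorted_list_of_multiset_mset)
  have len: "length es = n" by (simp add: es)
  have le_last: "e j \<le> es ! (n - 1)" if "j < n" for j
  proof -
    have "e j \<in> set es" using that by (auto simp: es)
    then obtain i where "i < n" "es ! i = e j" using len by (auto simp: in_set_conv_nth)
    then show ?thesis using sorted_nth_mono[of es i "n - 1"] len n by (auto simp: es)
  qed
  have quad: "(\<Sum>i<n. \<Sum>m<n. A $$ (i, m) * g i * v j m) = e j * (\<Sum>i<n. v j i * g i)" if "j < n" for j g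
  proof -
    have "(\<Sum>i<n. \<Sum>m<n. A $$ (i, m) * g i * v j m) = (\<Sum>i<n. g i * (\<Sum>m<n. A $$ (i, m) * v j m))"
      by (simp add: sum_distrib_left mult_ac)
    also have "\<dots> = (\<Sum>i<n. g i * (e j * v j i))"
      using that by (intro sum.cong) (auto simp: eigv)
    finally show ?thesis by (simp add: sum_distrib_left mult_ac)
  qed
  have ge_least: "\<mu> \<le> e j" if "j < n" for j
    using least[of "v j"] quad[OF that, of "v j"] orth[OF that that] by simp
  have second_le: "es ! 1 \<le> e j" if "0 < j" "j < n" for j
  proof -
    have upt: "[0..<n] = 0 # [1..<n]" using n by (simp add: upt_conv_Cons)
    \<comment> \<open>As a minimum, \<open>\<mu>\<close> is inserted in front, even if it occurs
      again; hence index 1 is the least of the other values.\<close>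
    have "es = \<mu> # sort (map e [1..<n])"
      unfolding es upt using ge_least n e0
      by (auto simp: e0 intro!: insort_is_Cons)
    moreover have "e j \<in> set (sort (map e [1..<n]))" using that by auto
    then obtain i where "i < length (sort (map e [1..<n]))" "sort (map e [1..<n]) ! i = e j"
      by (metis in_set_conv_nth)
    ultimately show ?thesis using sorted_nth_mono[of "sort (map e [1..<n])" 0 i] by simp
  qed
  define c where "c j = (\<Sum>i<n. v j i * f i)" for j
  have c0: "c 0 = 0" using f by (simp add: c_def v0)
  have complete: "(\<Sum>j<n. v j i * v j m) = (if i = m then 1 else 0)" if "i < n" "m < n" for i m
    using arg_cong[OF PPt, of "\<lambda>M. M $$ (i, m)"] that
    by (simp add: P_def scalar_prod_def lessThan_atLeast0)
  have f_eq: "f m = (\<Sum>j<n. c j * v j m)" if "m < n" for m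
  proof -
    have "(\<Sum>j<n. c j * v j m) = (\<Sum>i<n. f i * (\<Sum>j<n. v j i * v j m))"
      unfolding c_def sum_distrib_left sum_distrib_right by (subst sum.swap) (simp add: mult_ac)
    also have "\<dots> = (\<Sum>i<n. f i * (if i = m then 1 else 0))"
      using that by (intro sum.cong) (auto simp: complete)
    finally show ?thesis using that by (simp add: if_distrib cong: if_cong)
  qed
  have norm: "(\<Sum>i<n. f i * f i) = (\<Sum>j<n. (c j)\<^sup>2)"
  proof -
    have "(\<Sum>i<n. f i * f i) = (\<Sum>i<n. f i * (\<Sum>j<n. c j * v j i))" by (simp add: f_eq)
    also have "\<dots> = (\<Sum>j<n. c j * (\<Sum>i<n. v j i * f i))"
      unfolding sum_distrib_left by (subst sum.swap) (simp add: mult_ac)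
    finally show ?thesis by (simp add: c_def power2_eq_square)
  qed
  have form: "(\<Sum>i<n. \<Sum>m<n. A $$ (i, m) * f i * f m) = (\<Sum>j<n. e j * (c j)\<^sup>2)"
  proof -
    have "(\<Sum>i<n. \<Sum>m<n. A $$ (i, m) * f i * f m) = (\<Sum>i<n. \<Sum>m<n. \<Sum>j<n. c j * (A $$ (i, m) * f i * v j m))"
    proof (intro sum.cong refl)
      fix i m assume "m \<in> {..<n}"
      then show "A $$ (i, m) * f i * f m = (\<Sum>j<n. c j * (A $$ (i, m) * f i * v j m))"
        by (simp only: f_eq[of m] lessThan_iff sum_distrib_left mult_ac)
    qed
    also have "\<dots> = (\<Sum>i<n. \<Sum>j<n. \<Sum>m<n. c j * (A $$ (i, m) * f i * v j m))"
      by (rule sum.cong[OF refl]) (rule sum.swap)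
    also have "\<dots> = (\<Sum>j<n. c j * (\<Sum>i<n. \<Sum>m<n. A $$ (i, m) * f i * v j m))"
      unfolding sum_distrib_left by (rule sum.swap)
    also have "\<dots> = (\<Sum>j<n. c j * (e j * c j))" by (simp add: quad c_def)
    finally show ?thesis by (simp add: power2_eq_square mult_ac)
  qed
  show "es ! 1 * (\<Sum>i<n. f i * f i) \<le> (\<Sum>i<n. \<Sum>j<n. A $$ (i, j) * f i * f j)"
    unfolding norm form sum_distrib_left
  proof (rule sum_mono)
    fix j assume "j \<in> {..<n}"
    then show "es ! 1 * (c j)\<^sup>2 \<le> e j * (c j)\<^sup>2"
      using c0 second_le[of j] by (cases "j = 0") (auto intro: mult_right_mono)
  qed
  show "(\<Sum>i<n. \<Sum>j<n. A $$ (i, j) * f i * f j) \<le> es ! (n - 1) * (\<Sum>i<n. f i * f i)"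
    unfolding norm form sum_distrib_left using le_last by (intro sum_mono mult_right_mono) auto
qed

section \<open>The Laplacian\<close>

context
  fixes G :: "'a pair_pre_digraph" and vs :: "'a list" and n :: nat
  assumes G: "pair_graph G" and vs: "distinct vs" "set vs = pverts G" and n: "n = length vs"
begin

interpretation pair_graph G by (rule G)

lemma sum_nth_verts: "(\<Sum>i<n. g (vs ! i)) = (\<Sum>v\<in>pverts G. g v)"
  using sum.reindex_bij_betw[OF bij_betw_nth[OF vs(1) refl vs(2)[symmetric]], of g] by (simp add: n)

lemma out_degree_eq_sum:
  assumes "u \<in> pverts G"
  shows "real (out_degree (with_proj G) u) = (\<Sum>j<n. if (u, vs ! j) \<in> parcs G then 1 else 0)"
proof -
  have "out_arcs (with_proj G) u = Pair u ` {v \<in> pverts G. (u, v) \<in> parcs G}"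
    by (auto simp: image_iff dest: in_arcsD2)
  then have "out_degree (with_proj G) u = card {v \<in> pverts G. (u, v) \<in> parcs G}"
    by (simp add: out_degree_def card_image inj_on_def)
  moreover have "(\<Sum>j<n. if (u, vs ! j) \<in> parcs G then 1 else 0 :: real) =
      (\<Sum>v\<in>pverts G. if (u, v) \<in> parcs G then 1 else 0)"
    by (rule sum_nth_verts)
  ultimately show ?thesis by (simp add: sum.If_cases Int_def)
qed

lemma laplacian_carrier: "laplacian_matrix G vs \<in> carrier_mat n n"
  unfolding laplacian_matrix_def degree_matrix_def adjacency_matrix_def n
  by (intro minus_carrier_mat mat_carrier)

lemma laplacian_entry:
  assumes "i < n" "j < n"
  shows "laplacian_matrix G vs $$ (i, j) =
    (if i = j then \<Sum>k<n. if (vs ! i, vs ! k) \<in> parcs G then 1 else 0 else 0) -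
    (if (vs ! i, vs ! j) \<in> parcs G then 1 else 0)"
proof -
  have "vs ! i \<in> pverts G" using assms(1) vs(2) nth_mem[of i vs] by (simp add: n)
  from out_degree_eq_sum[OF this] show ?thesis
    using assms by (auto simp: laplacian_matrix_def degree_matrix_def adjacency_matrix_def n)
qed

lemma arc_commute: "(u, v) \<in> parcs G \<longleftrightarrow> (v, u) \<in> parcs G"
  using arcs_symmetric by auto

section \<open>The Laplacian energy\<close>

text \<open>The right-hand sum runs over ordered pairs and meets each edge twice, hence the factor
  2.\<close>

lemma laplacian_quadratic_form:
  "2 * (\<Sum>i<n. \<Sum>j<n. laplacian_matrix G vs $$ (i, j) * f i * f j) =
    (\<Sum>i<n. \<Sum>j<n. if (vs ! i, vs ! j) \<in> parcs G then (f i - f j)\<^sup>2 else 0)"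
proof -
  define a :: "nat \<Rightarrow> nat \<Rightarrow> real" where "a i j = (if (vs ! i, vs ! j) \<in> parcs G then 1 else 0)" for i j
  have a_sym: "a i j = a j i" for i j using arc_commute by (simp add: a_def)
  have "(\<Sum>i<n. \<Sum>j<n. laplacian_matrix G vs $$ (i, j) * f i * f j) =
      (\<Sum>i<n. (\<Sum>j<n. if i = j then (\<Sum>k<n. a i k) * f i * f j else 0) - (\<Sum>j<n. a i j * f i * f j))"
    unfolding sum_subtractf[symmetric]
    by (intro sum.cong refl) (simp add: laplacian_entry a_def[symmetric] algebra_simps)
  also have "\<dots> = (\<Sum>i<n. \<Sum>j<n. a i j * (f i)\<^sup>2) - (\<Sum>i<n. \<Sum>j<n. a i j * f i * f j)"
    by (simp add: sum_subtractf sum_distrib_left sum_distrib_right power2_eq_square mult_ac)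
  finally have form: "(\<Sum>i<n. \<Sum>j<n. laplacian_matrix G vs $$ (i, j) * f i * f j) =
      (\<Sum>i<n. \<Sum>j<n. a i j * (f i)\<^sup>2) - (\<Sum>i<n. \<Sum>j<n. a i j * f i * f j)" .
  have swap: "(\<Sum>i<n. \<Sum>j<n. a i j * (f j)\<^sup>2) = (\<Sum>i<n. \<Sum>j<n. a i j * (f i)\<^sup>2)"
    by (subst sum.swap) (simp add: a_sym)
  have "(\<Sum>i<n. \<Sum>j<n. if (vs ! i, vs ! j) \<in> parcs G then (f i - f j)\<^sup>2 else 0) =
      (\<Sum>i<n. \<Sum>j<n. a i j * (f i)\<^sup>2 + a i j * (f j)\<^sup>2 - 2 * (a i j * f i * f j))"
    by (intro sum.cong refl) (simp add: a_def power2_diff)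
  also have "\<dots> = 2 * (\<Sum>i<n. \<Sum>j<n. a i j * (f i)\<^sup>2) - 2 * (\<Sum>i<n. \<Sum>j<n. a i j * f i * f j)"
    by (simp add: sum.distrib sum_subtractf sum_distrib_left[symmetric] swap)
  finally show ?thesis unfolding form by simp
qed

lemma laplacian_rayleigh_bounds:
  assumes "2 \<le> n" and "(\<Sum>i<n. f i) = 0"
  shows "2 * laplacian_eigenvalue G vs 2 * (\<Sum>i<n. (f i)\<^sup>2) \<le>
      (\<Sum>i<n. \<Sum>j<n. if (vs ! i, vs ! j) \<in> parcs G then (f i - f j)\<^sup>2 else 0)"
    and "(\<Sum>i<n. \<Sum>j<n. if (vs ! i, vs ! j) \<in> parcs G then (f i - f j)\<^sup>2 else 0) \<le>
      2 * laplacian_eigenvalue G vs n * (\<Sum>i<n. (f i)\<^sup>2)"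
proof -
  \<comment> \<open>The normalised constant vector spans the known kernel direction; orthogonality
    to it means zero sum.\<close>
  define u :: "nat \<Rightarrow> real" where "u i = 1 / sqrt n" for i
  define L where "L = laplacian_matrix G vs"
  have unit: "(\<Sum>i<n. u i * u i) = 1" using assms(1) by (simp add: u_def)
  have sym: "L $$ (i, j) = L $$ (j, i)" if "i < n" "j < n" for i j
    using that arc_commute by (simp add: L_def laplacian_entry)
  have kernel: "(\<Sum>m<n. L $$ (i, m) * u m) = 0 * u i" if "i < n" for i
    using that by (simp add: L_def u_def laplacian_entry sum_subtractf sum_divide_distrib[symmetric] cong: if_cong)
  have psd: "0 * (\<Sum>i<n. g i * g i) \<le> (\<Sum>i<n. \<Sum>j<n. L $$ (i, j) * g i * g j)" for g
  proof -
    have "0 \<le> 2 * (\<Sum>i<n. \<Sum>j<n. L $$ (i, j) * g i * g j)"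
      unfolding L_def laplacian_quadratic_form by (intro sum_nonneg) auto
    then show ?thesis by simp
  qed
  have orth: "(\<Sum>i<n. u i * f i) = 0"
    using assms(2) by (simp add: u_def sum_divide_distrib[symmetric])
  note bounds = rayleigh_bounds[OF laplacian_carrier[folded L_def] assms(1) sym unit kernel psd orth]
  show "2 * laplacian_eigenvalue G vs 2 * (\<Sum>i<n. (f i)\<^sup>2) \<le>
      (\<Sum>i<n. \<Sum>j<n. if (vs ! i, vs ! j) \<in> parcs G then (f i - f j)\<^sup>2 else 0)"
    using bounds(1) unfolding laplacian_quadratic_form[symmetric] laplacian_eigenvalue_def L_def
    by (simp add: power2_eq_square)
  show "(\<Sum>i<n. \<Sum>j<n. if (vs ! i, vs ! j) \<in> parcs G then (f i - f j)\<^sup>2 else 0) \<le>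
      2 * laplacian_eigenvalue G vs n * (\<Sum>i<n. (f i)\<^sup>2)"
    using bounds(2) unfolding laplacian_quadratic_form[symmetric] laplacian_eigenvalue_def L_def
    by (simp add: power2_eq_square)
qed

section \<open>Separation of non-adjacent sets\<close>

text \<open>The centred vectors \<open>h s t\<close> and \<open>h s (- t)\<close> have equal energy.
  Bounding it below by \<open>m\<close> on one and above by \<open>M\<close> on the other compares
  their squared norms, \<open>4 * Q s (- t) \<le> 5 * Q s t\<close>; optimising this over
  \<open>s\<close> and \<open>t\<close> gives the claim.\<close>

lemma laplacian_separation:
  assumes n2: "2 \<le> n" and ratio: "laplacian_eigenvalue G vs 2 / laplacian_eigenvalue G vs n \<ge> 4 / 5"
    and XY: "X \<subseteq> pverts G" "Y \<subseteq> pverts G" "X \<inter> Y = {}"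
    and nonadj: "\<And>x y. x \<in> X \<Longrightarrow> y \<in> Y \<Longrightarrow> (x, y) \<notin> parcs G"
  shows "81 * (real (card X) * real (card Y)) \<le> (n - real (card X)) * (n - real (card Y))"
proof -
  define m where "m = laplacian_eigenvalue G vs 2"
  define M where "M = laplacian_eigenvalue G vs n"
  define x where "x = real (card X)"
  define y where "y = real (card Y)"
  define \<chi> :: "'a set \<Rightarrow> nat \<Rightarrow> real" where "\<chi> Z i = (if vs ! i \<in> Z then 1 else 0)" for Z i
  define h where "h s t i = s * \<chi> X i + t * \<chi> Y i - (s * x + t * y) / n" for s t i
  define E where "E f = (\<Sum>i<n. \<Sum>j<n. if (vs ! i, vs ! j) \<in> parcs G then (f i - f j)\<^sup>2 else 0)"
    for f :: "nat \<Rightarrow> real"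
  define Q where "Q s t = s\<^sup>2 * x + t\<^sup>2 * y - (s * x + t * y)\<^sup>2 / n" for s t
  have sum_\<chi>: "(\<Sum>i<n. \<chi> X i) = x" "(\<Sum>i<n. \<chi> Y i) = y"
    using XY sum_nth_verts[of "\<lambda>v. if v \<in> X then 1 else 0 :: real"]
      sum_nth_verts[of "\<lambda>v. if v \<in> Y then 1 else 0 :: real"]
    by (simp_all add: \<chi>_def x_def y_def sum.If_cases Int_absorb1)
  have mean: "(\<Sum>i<n. h s t i) = 0" for s t
    using n2 by (simp add: h_def sum.distrib sum_subtractf sum_distrib_left[symmetric] sum_\<chi>)
  have norm: "(\<Sum>i<n. (h s t i)\<^sup>2) = Q s t" for s t
  proof -
    define c where "c = (s * x + t * y) / n"
    have "(h s t i)\<^sup>2 = s\<^sup>2 * \<chi> X i + t\<^sup>2 * \<chi> Y i - 2 * c * (s * \<chi> X i + t * \<chi> Y i) + c\<^sup>2" for i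
      using XY(3) by (auto simp: h_def c_def[symmetric] \<chi>_def power2_eq_square algebra_simps)
    then have "(\<Sum>i<n. (h s t i)\<^sup>2) = s\<^sup>2 * x + t\<^sup>2 * y - 2 * c * (s * x + t * y) + n * c\<^sup>2"
      by (simp add: sum.distrib sum_subtractf sum_distrib_left[symmetric] sum_\<chi>)
    also have "n * c\<^sup>2 = c * (s * x + t * y)" using n2 by (simp add: c_def power2_eq_square)
    finally show ?thesis by (simp add: Q_def c_def power2_eq_square)
  qed
  \<comment> \<open>No arc joins \<open>X\<close> and \<open>Y\<close>, so the energy cannot see the sign of \<open>t\<close>, but the norm can.\<close>
  have energy: "E (h s t) = E (h s (- t))" for s t
    unfolding E_def
  proof (intro sum.cong refl if_cong)
    fix i j assume "(vs ! i, vs ! j) \<in> parcs G"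
    then have "\<chi> X i * \<chi> Y j = 0" "\<chi> X j * \<chi> Y i = 0" "\<chi> X i * \<chi> Y i = 0" "\<chi> X j * \<chi> Y j = 0"
      using nonadj[of "vs ! i" "vs ! j"] nonadj[of "vs ! j" "vs ! i"] XY(3) arc_commute[of "vs ! i" "vs ! j"]
      by (auto simp: \<chi>_def)
    then have "(\<chi> X i - \<chi> X j) * (\<chi> Y i - \<chi> Y j) = 0"
      unfolding left_diff_distrib right_diff_distrib by linarith
    moreover have "(h s t i - h s t j)\<^sup>2 - (h s (- t) i - h s (- t) j)\<^sup>2 =
        4 * s * t * ((\<chi> X i - \<chi> X j) * (\<chi> Y i - \<chi> Y j))"
      by (simp add: h_def power2_eq_square algebra_simps)
    ultimately show "(h s t i - h s t j)\<^sup>2 = (h s (- t) i - h s (- t) j)\<^sup>2"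
      by (simp only: mult_zero_right right_minus_eq)
  qed
  have lower: "2 * m * Q s t \<le> E (h s t)" and upper: "E (h s t) \<le> 2 * M * Q s t" for s t
    using laplacian_rayleigh_bounds[OF n2 mean[of s t]] by (simp_all add: norm m_def M_def E_def)
  have Q_nonneg: "0 \<le> Q s t" for s t
    unfolding norm[symmetric] by (intro sum_nonneg) auto
  have "M > 0"
  proof (rule ccontr)
    assume "\<not> M > 0"
    \<comment> \<open>A nonzero vector of zero sum has nonnegative energy, so the upper Rayleigh
      bound gives \<open>M \<ge> 0\<close>.\<close>
    define f :: "nat \<Rightarrow> real" where "f i = (if i = 0 then 1 else if i = 1 then - 1 else 0)" for i
    have split: "{..<n} = {0, 1} \<union> {2..<n}" using n2 by auto
    have f: "(\<Sum>i<n. f i) = 0" "(\<Sum>i<n. (f i)\<^sup>2) = 2"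
      unfolding split by (subst sum.union_disjoint; simp add: f_def)+
    have "0 \<le> E f" unfolding E_def by (intro sum_nonneg) auto
    then have "0 \<le> M" using laplacian_rayleigh_bounds(2)[OF n2 f(1)] by (simp add: f(2) M_def E_def)
    then have "M = 0" using \<open>\<not> M > 0\<close> by simp
    then show False using ratio by (simp add: M_def) \<comment> \<open>\<open>m / 0 = 0\<close>\<close>
  qed
  then have mM: "4 * M \<le> 5 * m" using ratio by (simp add: m_def M_def field_simps)
  have key: "18 * (s * x) * (t * y) \<le> s\<^sup>2 * x * (n - x) + t\<^sup>2 * y * (n - y)" for s t
  proof -
    have "M * (4 * Q s (- t)) \<le> 5 * m * Q s (- t)"
      using mult_right_mono[OF mM Q_nonneg[of s "- t"]] by simp
    also have "\<dots> \<le> M * (5 * Q s t)"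
      using lower[of s "- t"] upper[of s t] energy[of s t] by simp
    finally have "4 * Q s (- t) \<le> 5 * Q s t" using \<open>M > 0\<close> by simp
    then have "n * (4 * Q s (- t)) \<le> n * (5 * Q s t)" by (intro mult_left_mono) auto
    then have "4 * (n * Q s (- t)) \<le> 5 * (n * Q s t)" by (simp only: mult.left_commute)
    moreover have nQ: "n * Q s t = n * (s\<^sup>2 * x + t\<^sup>2 * y) - (s * x + t * y)\<^sup>2" for s t
      using n2 by (simp add: Q_def algebra_simps)
    ultimately have "4 * (n * (s\<^sup>2 * x + t\<^sup>2 * y) - (s * x - t * y)\<^sup>2) \<le>
        5 * (n * (s\<^sup>2 * x + t\<^sup>2 * y) - (s * x + t * y)\<^sup>2)"
      unfolding nQ by simp
    then show ?thesis by (simp add: power2_eq_square algebra_simps)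
  qed
  show ?thesis
  \<comment> \<open>These are the cases where the factor \<open>y * (n - x)\<close> cannot be
    cancelled; disjointness turns \<open>x = n\<close> into \<open>y = 0\<close>, so the left side
    vanishes.\<close>
  proof (cases "y = 0 \<or> x = n")
    case True
    have "card X + card Y = card (X \<union> Y)"
      using XY by (intro card_Un_disjoint[symmetric]) (auto intro: finite_subset)
    also have "\<dots> \<le> n" using XY vs by (auto simp: n distinct_card[symmetric] intro!: card_mono)
    finally show ?thesis using True by (auto simp: x_def y_def)
  next
    case False
    have "card X \<le> n" using XY vs by (auto simp: n distinct_card[symmetric] intro!: card_mono)
    then have pos: "0 < y * (n - x)" using False by (auto simp: x_def y_def)
    \<comment> \<open>The choice \<open>s = 9 * y\<close>, \<open>t = n - x\<close> extracts the
      discriminant condition of the quadratic form in \<open>key\<close>; \<open>81\<close> is the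
      square of half of \<open>18\<close>.\<close>
    have "(y * (n - x)) * (81 * (x * y)) \<le> (y * (n - x)) * ((n - x) * (n - y))"
      using key[of "9 * y" "n - x"] by (simp add: power2_eq_square algebra_simps)
    then show ?thesis unfolding x_def[symmetric] y_def[symmetric] by (rule mult_left_le_imp_le) (rule pos)
  qed
qed

end

theorem theorem11:
  fixes G :: "'a pair_pre_digraph" and vs :: "'a list" and n :: nat
  assumes "pair_graph G"
    and "card (pverts G) = n"
    and "parcs G \<noteq> {}"
    and "distinct vs" and "set vs = pverts G"
    and "laplacian_eigenvalue G vs 2 / laplacian_eigenvalue G vs n \<ge> 4 / 5"
  shows "\<exists>u p. is_k_walk 2 G u p"
proof -
  interpret pair_graph G by (rule assms(1))
  have len: "n = length vs" using assms(2,4,5) by (simp add: distinct_card[symmetric])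
  obtain u v where uv: "(u, v) \<in> parcs G" using assms(3) by auto
  then have "u \<noteq> v" "u \<in> pverts G" "v \<in> pverts G"
    using pair_no_loops[of "(u, v)"] by (auto dest: in_arcsD1 in_arcsD2)
  then have n2: "2 \<le> n"
    using card_mono[of "pverts G" "{u, v}"] assms(2) by simp
  have "\<exists>w. successively (\<lambda>u v. (u, v) \<in> parcs G) w \<and> 2 \<le> length w \<and> hd w = last w \<and>
    set w = pverts G \<and> (\<forall>v. count_list (tl w) v \<le> 2)"
  proof (rule expander_two_walk)
    show "sym (parcs G)" using arcs_symmetric by (auto intro: symI)
    show "parcs G \<subseteq> pverts G \<times> pverts G" by (auto dest: in_arcsD1 in_arcsD2)
    show "2 \<le> card (pverts G)" using n2 assms(2) by simp
    show "81 * (real (card X) * real (card Y)) \<le>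
        (card (pverts G) - real (card X)) * (card (pverts G) - real (card Y))"
      if "X \<subseteq> pverts G" "Y \<subseteq> pverts G" "X \<inter> Y = {}" "\<And>x y. x \<in> X \<Longrightarrow> y \<in> Y \<Longrightarrow> (x, y) \<notin> parcs G" for X Y
      using laplacian_separation[OF assms(1,4,5) len n2 assms(6) that] assms(2) by simp
  qed simp
  then show ?thesis using is_k_walk_of_vertex_list[of G _ 2] by blast
qed

end
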